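(* Let $T\ge 1$ and $\rho>0$ be fixed. For positive integers $N$ (with $N\le N_t$), let $\mathcal P^{(T)}(N)=\mathbf P\{\max_{n=1,\dots,N}SINR_n>T\}$ be the downlink coverage probability of the orthogonal random precoding scheme with $N$ precoding vectors and a single-antenna receiver. Then: (i) $\mathcal P^{(T)}(N)$ is a decreasing function of $N$; (ii) the maximum of $\mathcal P^{(T)}(N)$ over $N$ equals $e^{-T/\rho}$ and is achieved at $N^*=1$; (iii) for $N\ge2$, the larger $N$ is, the more slowly $\mathcal P^{(T)}(N)$ decreases, i.e. the decrement $\mathcal P^{(T)}(N)-\mathcal P^{(T)}(N+1)$ is a decreasing function of the integer $N\ge 2$.
   Context: Model. $h\in\mathbb C^{N_t\times 1}$ has i.i.d. circularly symmetric complex Gaussian entries $\mathcal{CN}(0,1)$. $\phi_1,\dots,\phi_N\in\mathbb C^{N_t\times1}$, $N\le N_t$, are (random) orthonormal precoding vectors, independent of $h$. $\rho>0$ is the average SNR. The signal-to-interference-plus-noise ratio of the $n$th beam is $$SINR_n=\frac{|h^T\phi_n|^2}{\frac N\rho+\sum_{i\ne n,\,1\le i\le N}|h^T\phi_i|^2},\qquad n=1,\dots,N.$$ The probability $\mathcal P^{(T)}(N)$ does not depend on $N_t\ge N$ (nor on the law of the orthonormal vectors); all values of $N$ occurring in the claim are assumed to satisfy $N\le N_t$. *)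

theory Defs
  imports "HOL-Probability.Probability"
begin

text \<open>
  The library's \<open>normal_density\<close> takes the standard deviation, so a circularly symmetric
  \<open>CN(0,1)\<close> variable has independent real and imaginary parts of standard deviation
  \<open>sqrt (1/2)\<close>.
\<close>

definition std_complex_gaussian :: "'a measure \<Rightarrow> ('a \<Rightarrow> complex) \<Rightarrow> bool" where
  "std_complex_gaussian M X \<longleftrightarrow>
     prob_space.indep_var M borel (\<lambda>\<omega>. Re (X \<omega>)) borel (\<lambda>\<omega>. Im (X \<omega>)) \<and>
     distributed M lborel (\<lambda>\<omega>. Re (X \<omega>)) (normal_density 0 (sqrt (1/2))) \<and>
     distributed M lborel (\<lambda>\<omega>. Im (X \<omega>)) (normal_density 0 (sqrt (1/2)))"

definition gaussian_channel :: "'a measure \<Rightarrow> ('a \<Rightarrow> complex ^ 'nt) \<Rightarrow> bool" where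
  "gaussian_channel M h \<longleftrightarrow>
     prob_space.indep_vars M (\<lambda>_. borel) (\<lambda>k \<omega>. h \<omega> $ k) (UNIV :: 'nt set) \<and>
     (\<forall>k. std_complex_gaussian M (\<lambda>\<omega>. h \<omega> $ k))"

text \<open>
  The library's \<open>indep_var\<close> forces both variables to have the same range type; this is
  independence of the generated sigma-algebras for arbitrary ranges.
\<close>

definition independent_rvs ::
  "'a measure \<Rightarrow> 'b measure \<Rightarrow> ('a \<Rightarrow> 'b) \<Rightarrow> 'c measure \<Rightarrow> ('a \<Rightarrow> 'c) \<Rightarrow> bool" where
  "independent_rvs M S X S' Y \<longleftrightarrow>
     X \<in> measurable M S \<and> Y \<in> measurable M S' \<and>
     prob_space.indep_set M
       (sets (vimage_algebra (space M) X S)) (sets (vimage_algebra (space M) Y S'))"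

text \<open>
  Beams are indexed by \<open>{1..N}\<close>. The whole family is jointly independent of the channel, with no
  restriction on its law beyond almost sure orthonormality.
\<close>

definition orthonormal_precoding ::
  "'a measure \<Rightarrow> ('a \<Rightarrow> complex ^ 'nt) \<Rightarrow> nat \<Rightarrow> (nat \<Rightarrow> 'a \<Rightarrow> complex ^ 'nt) \<Rightarrow> bool" where
  "orthonormal_precoding M h N \<phi> \<longleftrightarrow>
     (AE \<omega> in M. \<forall>m\<in>{1..N}. \<forall>n\<in>{1..N}.
        (\<Sum>k\<in>UNIV. cnj (\<phi> m \<omega> $ k) * \<phi> n \<omega> $ k) = (if m = n then 1 else 0)) \<and>
     independent_rvs M borel h
       (PiM {1..N} (\<lambda>_. borel)) (\<lambda>\<omega>. \<lambda>n\<in>{1..N}. \<phi> n \<omega>)"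

text \<open>The bilinear product \<open>x\<^sup>T y\<close>, without conjugation.\<close>

definition tdot :: "complex ^ 'nt \<Rightarrow> complex ^ 'nt \<Rightarrow> complex" where
  "tdot x y = (\<Sum>k\<in>UNIV. x $ k * y $ k)"

definition SINR ::
  "real \<Rightarrow> nat \<Rightarrow> complex ^ 'nt \<Rightarrow> (nat \<Rightarrow> complex ^ 'nt) \<Rightarrow> nat \<Rightarrow> real" where
  "SINR \<rho> N x v n =
     (cmod (tdot x (v n)))\<^sup>2 /
     (real N / \<rho> + (\<Sum>i\<in>{1..N} - {n}. (cmod (tdot x (v i)))\<^sup>2))"

definition coverage_prob ::
  "'a measure \<Rightarrow> real \<Rightarrow> real \<Rightarrow> ('a \<Rightarrow> complex ^ 'nt) \<Rightarrow> nat \<Rightarrow> (nat \<Rightarrow> 'a \<Rightarrow> complex ^ 'nt) \<Rightarrow> real"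
  where
  "coverage_prob M \<rho> T h N \<phi> =
     measure M {\<omega> \<in> space M. Max ((\<lambda>n. SINR \<rho> N (h \<omega>) (\<lambda>i. \<phi> i \<omega>) n) ` {1..N}) > T}"

end

theory Submission imports Defs begin

text \<open>
  The Gaussian density depends on the norm only and Lebesgue measure is invariant under linear
  isometries, so for orthonormal \<open>v 1, \<dots>, v N\<close> the variables \<open>h\<^sup>T v i\<close> have the same joint law as
  \<open>N\<close> coordinates of \<open>h\<close>. Conditioning on the independent precoding vectors, the squared moduli are
  therefore i.i.d. exponential. At most one SINR can exceed \<open>T \<ge> 1\<close>, so the events for the different
  beams are disjoint, and the exponential Laplace transform gives
  \<open>P N = N exp (- T N / \<rho>) / (1 + T) ^ (N - 1)\<close>. With \<open>z = exp (- T / \<rho>) / (1 + T) < 1/2\<close> this is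
  \<open>exp (- T / \<rho>) N z ^ (N - 1)\<close>, and the claims reduce to \<open>(N + 1) z < N\<close> and
  \<open>N - 2 (N + 1) z + (N + 2) z\<^sup>2 > 0\<close> for \<open>N \<ge> 2\<close>.
\<close>

subsection \<open>Gaussian measures on Euclidean spaces\<close>

lemma lborel_distr_linear_isometry:
  fixes f :: "'a::euclidean_space \<Rightarrow> 'a"
  assumes f: "linear f" "\<And>x. norm (f x) = norm x"
  shows "distr lborel borel f = lborel"
proof (rule measure_eqI)
  have cont: "continuous_on UNIV f"
    using f(1) by (simp add: linear_continuous_on linear_conv_bounded_linear)
  have [measurable]: "f \<in> borel_measurable borel"
    using cont by (rule borel_measurable_continuous_onI)
  have "inj f"
    using f by (metis linear_injective_0 norm_eq_zero)
  then have "surj f" using f(1) by (intro linear_injective_imp_surjective) auto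
  then have fg: "f (inv f y) = y" for y by (rule surj_f_inv_f)
  fix A :: "'a set"
  assume "A \<in> sets (distr lborel borel f)"
  then have [measurable]: "A \<in> sets borel" by simp
  \<comment> \<open>Weil's uniqueness argument for translation-invariant measures: integrate
    \<open>1\<^sub>A(f x + y) 1\<^sub>B(y)\<close> in both orders, with \<open>B\<close> the unit ball, whose volume is finite,
    positive and preserved by \<open>f\<close>.\<close>
  define B where "B = (ball 0 1 :: 'a set)"
  have [measurable]: "B \<in> sets borel" by (simp add: B_def)
  have shift: "(\<integral>\<^sup>+x. g x \<partial>lborel) = (\<integral>\<^sup>+x. g (c + x) \<partial>lborel)"
    if [measurable]: "g \<in> borel_measurable borel" for g :: "'a \<Rightarrow> ennreal" and c
    by (subst lborel_distr_plus[of c, symmetric], subst nn_integral_distr) auto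
  \<comment> \<open>By linearity and surjectivity \<open>y - f x = f (inv f y - x)\<close>, so the
    norm condition pulls back to a unit ball about \<open>inv f y\<close>. Its volume does not
    depend on \<open>y\<close>.\<close>
  have ballc: "emeasure lborel {x. y - f x \<in> B} = emeasure lborel B" for y
  proof -
    have "y - f x = f (inv f y - x)" for x
      using f(1) by (simp add: linear_diff fg)
    then have "{x. y - f x \<in> B} = ball (inv f y) 1"
      by (auto simp: B_def f dist_norm)
    then show ?thesis by (simp add: B_def emeasure_ball)
  qed
  have ind: "(\<integral>\<^sup>+x. indicator A (f x) \<partial>lborel) = emeasure lborel {x. f x \<in> A}"
    using nn_integral_indicator[of "{x. f x \<in> A}" lborel] by (simp add: indicator_def)
  have ind2: "(\<integral>\<^sup>+x. indicator B (y - f x) \<partial>lborel) = emeasure lborel {x. y - f x \<in> B}" for y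
    using nn_integral_indicator[of "{x. y - f x \<in> B}" lborel] by (simp add: indicator_def)
  have "emeasure lborel {x. f x \<in> A} * emeasure lborel B =
      (\<integral>\<^sup>+y. (\<integral>\<^sup>+x. indicator A (f x) * indicator B y \<partial>lborel) \<partial>lborel)"
    by (simp add: nn_integral_multc nn_integral_cmult ind)
  \<comment> \<open>For fixed \<open>y\<close>, translating \<open>x\<close> by
    \<open>inv f y\<close> in the domain moves \<open>f x\<close> by exactly
    \<open>y\<close>.\<close>
  also have "\<dots> = (\<integral>\<^sup>+y. (\<integral>\<^sup>+x. indicator A (f x + y) * indicator B y \<partial>lborel) \<partial>lborel)"
    using shift[of "\<lambda>x. indicator A (f x) * indicator B y" "inv f y" for y] f(1)
    by (simp add: linear_add fg add.commute)
  also have "\<dots> = (\<integral>\<^sup>+x. (\<integral>\<^sup>+y. indicator A (f x + y) * indicator B y \<partial>lborel) \<partial>lborel)"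
    by (rule lborel_pair.Fubini') measurable
  also have "\<dots> = (\<integral>\<^sup>+x. (\<integral>\<^sup>+y. indicator A y * indicator B (y - f x) \<partial>lborel) \<partial>lborel)"
    using shift[of "\<lambda>y. indicator A y * indicator B (y - c)" "c" for c]
    by simp
  also have "\<dots> = (\<integral>\<^sup>+y. (\<integral>\<^sup>+x. indicator A y * indicator B (y - f x) \<partial>lborel) \<partial>lborel)"
    by (rule lborel_pair.Fubini') measurable
  also have "\<dots> = (\<integral>\<^sup>+y. indicator A y * emeasure lborel {x. y - f x \<in> B} \<partial>lborel)"
    by (simp add: nn_integral_cmult ind2)
  also have "\<dots> = emeasure lborel A * emeasure lborel B"
    by (simp add: ballc nn_integral_multc)
  finally have *: "emeasure lborel {x. f x \<in> A} * emeasure lborel B = emeasure lborel A * emeasure lborel B" .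
  have "unit_ball_vol (real DIM('a)) \<noteq> 0" using unit_ball_vol_pos[of "real DIM('a)"] by linarith
  then have "emeasure lborel B \<noteq> 0" "emeasure lborel B \<noteq> \<infinity>"
    by (simp_all add: B_def emeasure_ball)
  with * have "emeasure lborel {x. f x \<in> A} = emeasure lborel A"
    by (simp add: mult.commute[of _ "emeasure lborel B"] ennreal_mult_cancel_left)
  then show "emeasure (distr lborel borel f) A = emeasure lborel A"
    by (simp add: emeasure_distr vimage_def)
qed simp

text \<open>The product form matches independent real coordinates;
  \<open>gaussian_density_eq\<close> supplies the radial form on which isometry invariance
  rests.\<close>

definition gaussian_density :: "real \<Rightarrow> 'a::euclidean_space \<Rightarrow> real" where
  "gaussian_density \<sigma> x = (\<Prod>b\<in>Basis. normal_density 0 \<sigma> (x \<bullet> b))"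

lemma gaussian_density_nonneg [simp]: "gaussian_density \<sigma> x \<ge> 0"
  by (simp add: gaussian_density_def prod_nonneg)

lemma borel_measurable_gaussian_density [measurable]:
  "gaussian_density \<sigma> \<in> borel_measurable borel"
  unfolding gaussian_density_def by measurable

text \<open>The squared coordinates add up in the exponent, leaving a function of the norm
  alone.\<close>

lemma gaussian_density_eq:
  assumes "\<sigma> > 0"
  shows "gaussian_density \<sigma> (x :: 'a :: euclidean_space) =
    (1 / sqrt (2 * pi * \<sigma>\<^sup>2)) ^ DIM('a) * exp (- (norm x)\<^sup>2 / (2 * \<sigma>\<^sup>2))"
proof -
  have "(norm x)\<^sup>2 = (\<Sum>b\<in>Basis. (x \<bullet> b)\<^sup>2)"
    unfolding power2_norm_eq_inner euclidean_inner[of x x] by (simp add: power2_eq_square)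
  then have *: "- (norm x)\<^sup>2 / (2 * \<sigma>\<^sup>2) = (\<Sum>b\<in>Basis. - (x \<bullet> b)\<^sup>2 / (2 * \<sigma>\<^sup>2))"
    by (simp add: sum_negf sum_divide_distrib)
  show ?thesis
    unfolding gaussian_density_def normal_density_def * exp_sum[OF finite_Basis]
    by (simp add: prod.distrib power_divide prod_dividef)
qed

text \<open>The density and the indicator of a box both split into one factor per coordinate, so the
  integral is a product of one-dimensional ones.\<close>

lemma emeasure_gaussian_box:
  fixes l u :: "'a :: euclidean_space"
  shows "emeasure (density lborel (\<lambda>x. ennreal (gaussian_density \<sigma> x))) (box l u) =
    (\<Prod>b\<in>Basis. emeasure (density lborel (\<lambda>x. ennreal (normal_density 0 \<sigma> x))) {l \<bullet> b<..<u \<bullet> b})"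
proof -
  have "emeasure (density lborel (\<lambda>x. ennreal (gaussian_density \<sigma> x))) (box l u) =
    (\<integral>\<^sup>+x. (\<Prod>b\<in>Basis. ennreal (normal_density 0 \<sigma> (x \<bullet> b)) * indicator {l \<bullet> b<..<u \<bullet> b} (x \<bullet> b)) \<partial>lborel)"
  proof (subst emeasure_density, simp, simp, rule nn_integral_cong)
    fix x :: 'a
    have "indicator (box l u) x = (\<Prod>b\<in>Basis. indicator {l \<bullet> b<..<u \<bullet> b} (x \<bullet> b) :: ennreal)"
    proof (cases "x \<in> box l u")
      case True
      then show ?thesis by (simp add: mem_box)
    next
      case False
      then obtain b where "b \<in> Basis" "x \<bullet> b \<notin> {l \<bullet> b<..<u \<bullet> b}" by (auto simp: mem_box)
      then have "(\<Prod>b\<in>Basis. indicator {l \<bullet> b<..<u \<bullet> b} (x \<bullet> b) :: ennreal) = 0"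
        by (intro prod_zero) (auto intro!: bexI[of _ b])
      with False show ?thesis by simp
    qed
    then show "ennreal (gaussian_density \<sigma> x) * indicator (box l u) x =
      (\<Prod>b\<in>Basis. ennreal (normal_density 0 \<sigma> (x \<bullet> b)) * indicator {l \<bullet> b<..<u \<bullet> b} (x \<bullet> b))"
      by (simp add: gaussian_density_def prod.distrib prod_ennreal)
  qed
  also have "\<dots> = (\<Prod>b\<in>Basis. \<integral>\<^sup>+x. ennreal (normal_density 0 \<sigma> x) * indicator {l \<bullet> b<..<u \<bullet> b} x \<partial>lborel)"
    by (rule nn_integral_lborel_prod) auto
  finally show ?thesis by (simp add: emeasure_density)
qed

text \<open>Open boxes generate the Borel sets, are closed under intersection, and countably many of
  them cover the space, so a probability law is determined by its values on boxes. Serves both for a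
  single complex entry and for the whole channel vector.\<close>

lemma distr_gaussianI:
  fixes X :: "'b \<Rightarrow> 'a :: euclidean_space"
  assumes "prob_space M" and [measurable]: "X \<in> borel_measurable M"
    and box: "\<And>l u. emeasure M {\<omega> \<in> space M. X \<omega> \<in> box l u} =
      (\<Prod>b\<in>Basis. emeasure (density lborel (\<lambda>x. ennreal (normal_density 0 \<sigma> x))) {l \<bullet> b<..<u \<bullet> b})"
  shows "distr M borel X = density lborel (\<lambda>x. ennreal (gaussian_density \<sigma> x))"
proof (rule measure_eqI_generator_eq)
  interpret prob_space M by fact
  let ?E = "range (\<lambda>(a, b). box a b::'a set)"
  show "Int_stable ?E"
    by (auto simp: Int_stable_def box_Int_box)
  show "?E \<subseteq> Pow UNIV" "sets (distr M borel X) = sigma_sets UNIV ?E"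
     "sets (density lborel (\<lambda>x. ennreal (gaussian_density \<sigma> x))) = sigma_sets UNIV ?E"
    by (simp_all add: borel_eq_box)
  let ?A = "\<lambda>n::nat. box (- (real n *\<^sub>R One)) (real n *\<^sub>R One) :: 'a set"
  show "range ?A \<subseteq> ?E" "(\<Union>i. ?A i) = UNIV"
    unfolding UN_box_eq_UNIV by auto
  show "emeasure (distr M borel X) (?A i) \<noteq> \<infinity>" for i
    by (simp add: emeasure_distr)
  show "emeasure (distr M borel X) Y = emeasure (density lborel (\<lambda>x. ennreal (gaussian_density \<sigma> x))) Y"
    if "Y \<in> ?E" for Y
  proof -
    from that obtain l u where Y: "Y = box l u" by auto
    show ?thesis unfolding Y emeasure_gaussian_box box[symmetric]
      by (simp add: emeasure_distr vimage_def Int_def conj_commute)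
  qed
qed

text \<open>Lebesgue measure and the radial density are each invariant under \<open>f\<close>, so
  the pushforward of their combination is unchanged.\<close>

lemma gaussian_distr_linear_isometry:
  fixes f :: "'a::euclidean_space \<Rightarrow> 'a"
  assumes f: "linear f" "\<And>x. norm (f x) = norm x" and "\<sigma> > 0"
  shows "distr (density lborel (\<lambda>x. ennreal (gaussian_density \<sigma> x))) borel f =
    density lborel (\<lambda>x. ennreal (gaussian_density \<sigma> x))"
proof -
  have [measurable]: "f \<in> borel_measurable borel"
    using f(1) by (intro borel_measurable_continuous_onI) (simp add: linear_continuous_on linear_conv_bounded_linear)
  have "density lborel (\<lambda>x. ennreal (gaussian_density \<sigma> x)) =
    density (distr lborel borel f) (\<lambda>x. ennreal (gaussian_density \<sigma> x))"
    by (simp add: lborel_distr_linear_isometry f)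
  also have "\<dots> = distr (density lborel (\<lambda>x. ennreal (gaussian_density \<sigma> (f x)))) borel f"
    by (subst density_distr) auto
  also have "(\<lambda>x. gaussian_density \<sigma> (f x)) = gaussian_density \<sigma>"
    by (simp add: gaussian_density_eq f \<open>\<sigma> > 0\<close> fun_eq_iff)
  finally show ?thesis by (simp add: fun_eq_iff)
qed

subsection \<open>The Gaussian channel\<close>

lemma emeasure_distributed:
  assumes "distributed M lborel X f" and [measurable]: "A \<in> sets borel"
  shows "emeasure M {\<omega> \<in> space M. X \<omega> \<in> A} = emeasure (density lborel f) A"
proof -
  have [measurable]: "X \<in> borel_measurable M"
    using distributed_measurable[OF assms(1)] by simp
  have "emeasure M {\<omega> \<in> space M. X \<omega> \<in> A} = emeasure (distr M lborel X) A"
    by (subst emeasure_distr) (auto simp: vimage_def Int_def conj_commute)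
  then show ?thesis
    using distributed_distr_eq_density[OF assms(1)] by simp
qed

lemma borel_measurable_complexI:
  fixes X :: "'a \<Rightarrow> complex"
  assumes [measurable]: "(\<lambda>\<omega>. Re (X \<omega>)) \<in> borel_measurable M" "(\<lambda>\<omega>. Im (X \<omega>)) \<in> borel_measurable M"
  shows "X \<in> borel_measurable M"
proof -
  have "(\<lambda>\<omega>. complex_of_real (Re (X \<omega>)) + \<i> * complex_of_real (Im (X \<omega>))) \<in> borel_measurable M"
    by measurable
  then show ?thesis by (simp flip: complex_eq)
qed

lemma box_complex_iff:
  "z \<in> box l u \<longleftrightarrow> Re z \<in> {Re l<..<Re u} \<and> Im z \<in> {Im l<..<Im u}"
  by (auto simp: mem_box Basis_complex_def)

text \<open>With the basis \<open>1\<close>, \<open>\<i>\<close> a box in the complex plane is a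
  rectangle in real and imaginary part, whose probability factors by independence.\<close>

lemma std_complex_gaussian_emeasure_box:
  assumes "prob_space M" "std_complex_gaussian M X"
  shows "emeasure M {\<omega> \<in> space M. X \<omega> \<in> box l u} =
      (\<Prod>b\<in>Basis. emeasure (density lborel (\<lambda>x. ennreal (normal_density 0 (sqrt (1/2)) x))) {l \<bullet> b<..<u \<bullet> b})"
proof -
  interpret prob_space M by fact
  let ?D = "density lborel (\<lambda>x. ennreal (normal_density 0 (sqrt (1/2)) x))"
  have ind: "indep_var borel (\<lambda>\<omega>. Re (X \<omega>)) borel (\<lambda>\<omega>. Im (X \<omega>))"
    and re: "distributed M lborel (\<lambda>\<omega>. Re (X \<omega>)) (normal_density 0 (sqrt (1/2)))"
    and im: "distributed M lborel (\<lambda>\<omega>. Im (X \<omega>)) (normal_density 0 (sqrt (1/2)))"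
    using assms(2) by (auto simp: std_complex_gaussian_def)
  have "prob {\<omega> \<in> space M. X \<omega> \<in> box l u} =
     prob ((\<lambda>x. (Re (X x), Im (X x))) -` ({Re l<..<Re u} \<times> {Im l<..<Im u}) \<inter> space M)"
    by (rule arg_cong[where f=prob]) (auto simp: box_complex_iff)
  also have "\<dots> = prob ((\<lambda>x. Re (X x)) -` {Re l<..<Re u} \<inter> space M) * prob ((\<lambda>x. Im (X x)) -` {Im l<..<Im u} \<inter> space M)"
    by (rule indep_varD[OF ind]) auto
  finally have "emeasure M {\<omega> \<in> space M. X \<omega> \<in> box l u} =
    emeasure M {\<omega> \<in> space M. Re (X \<omega>) \<in> {Re l<..<Re u}} * emeasure M {\<omega> \<in> space M. Im (X \<omega>) \<in> {Im l<..<Im u}}"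
    by (simp add: emeasure_eq_measure ennreal_mult[symmetric] vimage_def Int_def conj_commute)
  also have "\<dots> = emeasure ?D {Re l<..<Re u} * emeasure ?D {Im l<..<Im u}"
    using emeasure_distributed[OF re, of "{Re l<..<Re u}"] emeasure_distributed[OF im, of "{Im l<..<Im u}"]
    by simp
  finally show ?thesis by (simp add: Basis_complex_def)
qed

lemma std_complex_gaussian_measurable:
  assumes "std_complex_gaussian M X"
  shows "X \<in> borel_measurable M"
  using assms distributed_measurable[of M lborel "\<lambda>\<omega>. Re (X \<omega>)"] distributed_measurable[of M lborel "\<lambda>\<omega>. Im (X \<omega>)"]
  by (intro borel_measurable_complexI) (auto simp: std_complex_gaussian_def)

lemma std_complex_gaussian_distr:
  assumes "prob_space M" "std_complex_gaussian M X"
  shows "distr M borel X = density lborel (\<lambda>x. ennreal (gaussian_density (sqrt (1/2)) x))"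
  by (intro distr_gaussianI assms std_complex_gaussian_measurable[OF assms(2)]
       std_complex_gaussian_emeasure_box)

lemma borel_measurable_vecI:
  fixes X :: "'a \<Rightarrow> 'b::euclidean_space ^ 'n"
  assumes [measurable]: "\<And>k. (\<lambda>\<omega>. X \<omega> $ k) \<in> borel_measurable M"
  shows "X \<in> borel_measurable M"
proof -
  have "(\<lambda>\<omega>. X \<omega> \<bullet> b) \<in> borel_measurable M" if "b \<in> Basis" for b
  proof -
    from that obtain k u where b: "b = axis k u" by (auto simp: Basis_vec_def)
    show ?thesis unfolding b inner_axis by measurable
  qed
  then show ?thesis by (subst borel_measurable_euclidean_space) auto
qed

text \<open>The basis vectors are the \<open>axis k u\<close>, each for exactly one pair of a
  position \<open>k\<close> and a basis element \<open>u\<close> of the entry type. This merges the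
  product over antennas with the one over real and imaginary parts.\<close>

lemma prod_Basis_vec:
  fixes f :: "'b::euclidean_space ^ 'n \<Rightarrow> 'c::comm_monoid_mult"
  shows "(\<Prod>b\<in>Basis. f b) = (\<Prod>k\<in>UNIV. \<Prod>u\<in>Basis. f (axis k u))"
proof -
  have "(\<Prod>k\<in>UNIV. \<Prod>u\<in>Basis. f (axis k u)) = (\<Prod>(k,u)\<in>UNIV \<times> Basis. f (axis k u))"
    by (rule prod.cartesian_product)
  also have "\<dots> = (\<Prod>b\<in>(\<lambda>(k,u). axis k u) ` (UNIV \<times> Basis). f b)"
    by (subst prod.reindex) (auto simp: inj_on_def axis_eq_axis split_def intro!: prod.cong)
  also have "(\<lambda>(k,u). axis k u) ` (UNIV \<times> Basis) = (Basis :: ('b ^ 'n) set)"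
    by (auto simp: Basis_vec_def)
  finally show ?thesis by simp
qed

lemma box_vec_iff:
  fixes x :: "'b::euclidean_space ^ 'n"
  shows "x \<in> box l u \<longleftrightarrow> (\<forall>k. x $ k \<in> box (l $ k) (u $ k))"
  by (auto simp: mem_box Basis_vec_def inner_axis)

lemma gaussian_channel_measurable:
  assumes "gaussian_channel M h"
  shows "h \<in> borel_measurable M"
  using assms by (intro borel_measurable_vecI std_complex_gaussian_measurable) (auto simp: gaussian_channel_def)

text \<open>A box constrains each entry separately. Independence of the entries, and then of the two
  parts of each entry, turns its probability into a product over all real coordinates.\<close>

lemma gaussian_channel_distr:
  fixes h :: "'a \<Rightarrow> complex ^ 'nt"
  assumes "prob_space M" "gaussian_channel M h"
  shows "distr M borel h = density lborel (\<lambda>x. ennreal (gaussian_density (sqrt (1/2)) x))"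
proof (rule distr_gaussianI)
  interpret prob_space M by fact
  show "prob_space M" by fact
  show "h \<in> borel_measurable M" using assms(2) by (rule gaussian_channel_measurable)
  let ?D = "density lborel (\<lambda>x. ennreal (normal_density 0 (sqrt (1/2)) x))"
  fix l u :: "complex ^ 'nt"
  have ind: "indep_vars (\<lambda>_. borel) (\<lambda>k \<omega>. h \<omega> $ k) (UNIV :: 'nt set)"
    and g: "\<And>k. std_complex_gaussian M (\<lambda>\<omega>. h \<omega> $ k)"
    using assms(2) by (auto simp: gaussian_channel_def)
  have "prob {\<omega> \<in> space M. h \<omega> \<in> box l u} =
     prob (\<Inter>k\<in>UNIV. (\<lambda>\<omega>. h \<omega> $ k) -` box (l $ k) (u $ k) \<inter> space M)"
    by (rule arg_cong[where f=prob]) (auto simp: box_vec_iff)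
  also have "\<dots> = (\<Prod>k\<in>UNIV. prob ((\<lambda>\<omega>. h \<omega> $ k) -` box (l $ k) (u $ k) \<inter> space M))"
    by (rule indep_varsD[OF ind]) auto
  finally have "emeasure M {\<omega> \<in> space M. h \<omega> \<in> box l u} =
    (\<Prod>k\<in>UNIV. emeasure M {\<omega> \<in> space M. h \<omega> $ k \<in> box (l $ k) (u $ k)})"
    by (simp add: emeasure_eq_measure prod_ennreal vimage_def Int_def conj_commute)
  also have "\<dots> = (\<Prod>k\<in>UNIV. \<Prod>b\<in>Basis. emeasure ?D {(l $ k) \<bullet> b<..<(u $ k) \<bullet> b})"
    by (simp add: std_complex_gaussian_emeasure_box[OF assms(1) g])
  also have "\<dots> = (\<Prod>b\<in>Basis. emeasure ?D {l \<bullet> b<..<u \<bullet> b})"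
    by (simp add: prod_Basis_vec inner_axis)
  finally show "emeasure M {\<omega> \<in> space M. h \<omega> \<in> box l u} =
      (\<Prod>b\<in>Basis. emeasure ?D {l \<bullet> b<..<u \<bullet> b})" .
qed

section \<open>Exponential law of the squared modulus of a Gaussian entry\<close>

lemma emeasure_std_complex_gaussian_norm_gt:
  assumes "prob_space M" "std_complex_gaussian M X" and "s \<ge> 0"
  shows "emeasure M {\<omega> \<in> space M. (cmod (X \<omega>))\<^sup>2 > s} = exp (- s)"
proof -
  let ?S = "{z. (cmod z)\<^sup>2 > s}"
  have [measurable]: "X \<in> borel_measurable M"
    using assms(2) by (rule std_complex_gaussian_measurable)
  have [measurable]: "?S \<in> sets borel" by measurable
  \<comment> \<open>Variance \<open>1/2\<close> in each of the two real directions makes the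
    exponent exactly minus the squared modulus and the constant
    \<open>(1 / sqrt pi) ^ 2\<close>.\<close>
  have dens: "gaussian_density (sqrt (1/2)) z = exp (- (cmod z)\<^sup>2) / pi" for z :: complex
  proof -
    have "(sqrt (1/2))\<^sup>2 = 1 / (2 :: real)" by (rule real_sqrt_pow2) simp
    then show ?thesis
      by (subst gaussian_density_eq, simp, simp only:) (simp add: power_divide)
  qed
  \<comment> \<open>Layer cake: \<open>exp (- |z|\<^sup>2)\<close> is the integral of \<open>exp (- u)\<close> over \<open>u > |z|\<^sup>2\<close>, so Fubini leaves
    only areas of annuli; no polar coordinates are needed.\<close>
  have exp_shift: "ennreal (exp (- a - u)) = ennreal (exp (- a)) * ennreal (exp (- u))" for a u :: real
    by (simp add: exp_add[symmetric] flip: ennreal_mult)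
  have shift: "(\<integral>\<^sup>+u. f u \<partial>lborel) = (\<integral>\<^sup>+u. f (a + u) \<partial>lborel)"
    if "f \<in> borel_measurable borel" for f :: "real \<Rightarrow> ennreal" and a
    using nn_integral_real_affine[OF that, of 1 a] by simp
  have exp_tail: "ennreal (exp (- a)) = (\<integral>\<^sup>+u. ennreal (exp (- u)) * indicator {a<..} u \<partial>lborel)" for a :: real
  proof -
    have "(\<integral>\<^sup>+u. ennreal (exp (- u)) * indicator {a<..} u \<partial>lborel) =
      (\<integral>\<^sup>+u. ennreal (exp (- a)) * (ennreal (exp (- u)) * indicator {0<..} u) \<partial>lborel)"
      by (subst shift[where a=a], simp, rule nn_integral_cong)
         (simp add: exp_shift mult.assoc indicator_def)
    also have "\<dots> = ennreal (exp (- a)) * (\<integral>\<^sup>+u. ennreal (exp (- u)) * indicator {0<..} u \<partial>lborel)"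
      by (rule nn_integral_cmult) auto
    also have "(\<integral>\<^sup>+u. ennreal (exp (- u)) * indicator {0<..} u \<partial>lborel) =
       (\<integral>\<^sup>+u. ennreal (u ^ 0 * exp (- u)) * indicator {0..} u \<partial>lborel)"
    proof (rule nn_integral_cong_AE)
      \<comment> \<open>The open and the closed half-line differ only in the null set
        \<open>{0}\<close>.\<close>
      show "AE u in lborel. ennreal (exp (- u)) * indicator {0<..} u = ennreal (u ^ 0 * exp (- u)) * indicator {0..} u"
        using AE_lborel_singleton[of "0::real"] by eventually_elim (auto split: split_indicator)
    qed
    also have "\<dots> = 1" by (subst nn_intergal_power_times_exp_Ici) simp
    finally show ?thesis by simp
  qed
  \<comment> \<open>The area is a difference of two discs. At \<open>u = s\<close> the linear factor
    vanishes, so the closed indicator agrees with the empty annulus there.\<close>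
  have ring: "emeasure lborel {z :: complex. s < (cmod z)\<^sup>2 \<and> (cmod z)\<^sup>2 < u} = ennreal (pi * (u - s)) * indicator {s..} u" for u
  proof (cases "s < u")
    case True
    have "s < (cmod z)\<^sup>2 \<longleftrightarrow> sqrt s < cmod z" "(cmod z)\<^sup>2 < u \<longleftrightarrow> cmod z < sqrt u" for z
      using real_sqrt_less_iff[of s "(cmod z)\<^sup>2"] real_sqrt_less_iff[of "(cmod z)\<^sup>2" u] by auto
    then have "{z :: complex. s < (cmod z)\<^sup>2 \<and> (cmod z)\<^sup>2 < u} = ball 0 (sqrt u) - cball 0 (sqrt s)"
      by auto
    moreover have "emeasure lborel (ball (0::complex) (sqrt u) - cball 0 (sqrt s)) = ennreal (pi * u) - ennreal (pi * s)"
      using True \<open>s \<ge> 0\<close> by (subst emeasure_Diff) (auto simp: emeasure_ball emeasure_cball unit_ball_vol_2 subset_iff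
        intro: le_less_trans[of _ "sqrt s"])
    ultimately show ?thesis using True \<open>s \<ge> 0\<close>
      by (auto simp: ennreal_minus right_diff_distrib)
  next
    case False
    then have empty: "{z :: complex. s < (cmod z)\<^sup>2 \<and> (cmod z)\<^sup>2 < u} = {}" by auto
    show ?thesis unfolding empty using False by (auto simp: indicator_def)
  qed
  have "emeasure M {\<omega> \<in> space M. (cmod (X \<omega>))\<^sup>2 > s} = emeasure (distr M borel X) ?S"
    by (subst emeasure_distr) (auto simp: vimage_def Int_def conj_commute)
  also have "\<dots> = (\<integral>\<^sup>+z. ennreal (1 / pi) * (ennreal (exp (- (cmod z)\<^sup>2)) * indicator ?S z) \<partial>lborel)"
    unfolding std_complex_gaussian_distr[OF assms(1,2)] dens
    by (subst emeasure_density, simp, simp, rule nn_integral_cong)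
       (simp add: mult.assoc[symmetric] flip: ennreal_mult)
  also have "\<dots> = ennreal (1 / pi) * (\<integral>\<^sup>+z. ennreal (exp (- (cmod z)\<^sup>2)) * indicator ?S z \<partial>lborel)"
    by (rule nn_integral_cmult) auto
  also have "(\<integral>\<^sup>+z. ennreal (exp (- (cmod z)\<^sup>2)) * indicator ?S z \<partial>lborel) =
     (\<integral>\<^sup>+z. (\<integral>\<^sup>+u. ennreal (exp (- u)) * indicator {(cmod z)\<^sup>2<..} u * indicator ?S z \<partial>lborel) \<partial>lborel)"
    by (rule nn_integral_cong, subst exp_tail, rule nn_integral_multc[symmetric]) simp
  also have "\<dots> = (\<integral>\<^sup>+u. (\<integral>\<^sup>+z. ennreal (exp (- u)) * indicator {(cmod z)\<^sup>2<..} u * indicator ?S z \<partial>lborel) \<partial>lborel)"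
    unfolding indicator_def of_bool_def greaterThan_iff mem_Collect_eq
    by (rule lborel_pair.Fubini') measurable
  also have "\<dots> = (\<integral>\<^sup>+u. ennreal (exp (- u)) * emeasure lborel {z :: complex. s < (cmod z)\<^sup>2 \<and> (cmod z)\<^sup>2 < u} \<partial>lborel)"
    by (intro nn_integral_cong, subst nn_integral_cmult_indicator[symmetric])
       (auto intro!: nn_integral_cong split: split_indicator)
  \<comment> \<open>Replacing \<open>u\<close> by \<open>s + u\<close> pulls out
    \<open>exp (- s)\<close>, and the annulus area becomes \<open>pi * u\<close>: what remains is a
    Gamma integral of value 1.\<close>
  also have "\<dots> = (\<integral>\<^sup>+u. ennreal (pi * exp (- s)) * (ennreal (u ^ 1 * exp (- u)) * indicator {0..} u) \<partial>lborel)"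
    unfolding ring
    by (subst shift[where a=s], simp, rule nn_integral_cong)
       (simp add: exp_shift ennreal_mult mult_ac indicator_def)
  also have "\<dots> = ennreal (pi * exp (- s)) * (\<integral>\<^sup>+u. (ennreal (u ^ 1 * exp (- u)) * indicator {0..} u) \<partial>lborel)"
    by (rule nn_integral_cmult) auto
  also have "(\<integral>\<^sup>+u. ennreal (u ^ 1 * exp (- u)) * indicator {0..} u \<partial>lborel) = 1"
    by (subst nn_intergal_power_times_exp_Ici) simp
  finally show ?thesis by (simp flip: ennreal_mult)
qed

subsection \<open>Extending orthonormal families to isometries\<close>

lemma orthonormal_family_linear_isometry:
  fixes a :: "'a::euclidean_space \<Rightarrow> 'a"
  assumes B0: "B0 \<subseteq> Basis"
    and a: "\<And>b c. b \<in> B0 \<Longrightarrow> c \<in> B0 \<Longrightarrow> a b \<bullet> a c = (if b = c then 1 else 0)"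
  obtains f :: "'a \<Rightarrow> 'a" where "linear f" "\<And>x. norm (f x) = norm x"
    "\<And>b x. b \<in> B0 \<Longrightarrow> f x \<bullet> b = x \<bullet> a b"
proof -
  have "pairwise orthogonal (a ` B0)"
    by (auto simp: pairwise_def orthogonal_def a)
  then obtain U where U: "U \<inter> insert 0 (a ` B0) = {}" "pairwise orthogonal (a ` B0 \<union> U)"
    "span (a ` B0 \<union> U) = span (a ` B0 \<union> UNIV)"
    by (rule orthogonal_extension_strong[where T=UNIV])
  define V where "V = (\<lambda>u. u /\<^sub>R norm u) ` U"
  define C where "C = a ` B0 \<union> V"
  have inja: "inj_on a B0"
    by (rule inj_onI) (metis a zero_neq_one)
  have norma: "norm (a b) = 1" if "b \<in> B0" for b
    using a[OF that that] by (simp add: norm_eq_1)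
  have orthU: "x \<bullet> y = 0" if "x \<in> a ` B0 \<union> U" "y \<in> a ` B0 \<union> U" "x \<noteq> y" for x y
    using U(2) that by (auto simp: pairwise_def orthogonal_def)
  have "0 \<notin> U" using U(1) by auto
  have orthC: "pairwise orthogonal C"
  proof -
    have "x \<bullet> y = 0" if "x \<in> V" "y \<in> V" "x \<noteq> y" for x y
      using that orthU by (fastforce simp: V_def)
    moreover have *: "x \<bullet> y = 0" if x: "x \<in> a ` B0" and y: "y \<in> V" for x y
    proof -
      obtain u where u: "u \<in> U" "y = u /\<^sub>R norm u" using y by (auto simp: V_def)
      then have "x \<noteq> u" using U(1) x by auto
      then show ?thesis using orthU[of x u] u x by simp
    qed
    moreover have "y \<bullet> x = 0" if "x \<in> a ` B0" "y \<in> V" for x y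
      using *[OF that] by (simp add: inner_commute)
    ultimately show ?thesis
      using U(2) by (auto simp: pairwise_def orthogonal_def C_def)
  qed
  have normC: "norm c = 1" if "c \<in> C" for c
    using that \<open>0 \<notin> U\<close> by (auto simp: C_def V_def norma intro!: left_inverse)
  \<comment> \<open>Normalising an element of \<open>U\<close> cannot produce a member of the given
    family, since that vector would be orthogonal to itself.\<close>
  have disj: "a ` B0 \<inter> V = {}"
  proof (rule ccontr)
    assume "a ` B0 \<inter> V \<noteq> {}"
    then obtain x where "x \<in> a ` B0" "x \<in> V" by auto
    then obtain u where "u \<in> U" "x = u /\<^sub>R norm u" by (auto simp: V_def)
    moreover have "x \<noteq> u" using U(1) \<open>x \<in> a ` B0\<close> \<open>u \<in> U\<close> by auto
    ultimately have "x \<bullet> x = 0" using orthU[of x u] \<open>x \<in> a ` B0\<close> by simp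
    with \<open>x \<in> a ` B0\<close> show False using norma by (metis imageE inner_eq_zero_iff norm_zero zero_neq_one)
  qed
  have "0 \<notin> C" using normC by fastforce
  have indC: "independent C" using orthC \<open>0 \<notin> C\<close> by (rule pairwise_orthogonal_independent)
  have "finite C" using indC by (rule independent_imp_finite)
  have spanC: "span C = UNIV"
  proof -
    have "a ` B0 \<union> U \<subseteq> span C"
    proof
      fix x assume x: "x \<in> a ` B0 \<union> U"
      show "x \<in> span C"
      proof (cases "x \<in> U")
        case True
        then have "norm x *\<^sub>R (x /\<^sub>R norm x) \<in> span C"
          by (intro span_scale span_base) (auto simp: C_def V_def)
        then show ?thesis using True \<open>0 \<notin> U\<close> by (cases "x = 0") auto
      next
        case False with x show ?thesis by (auto simp: C_def intro: span_base)
      qed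
    qed
    then have "span (a ` B0 \<union> U) \<subseteq> span C" by (simp add: span_minimal)
    then show ?thesis using U(3) by auto
  qed
  \<comment> \<open>Counting: the basis \<open>C\<close> has as many elements as
    \<open>Basis\<close>, so the added vectors are exactly as many as the basis vectors outside
    \<open>B0\<close>.\<close>
  have "card C = DIM('a)"
    using indC spanC by (metis dim_UNIV dim_eq_card_independent dim_span)
  moreover have "card C = card B0 + card V"
    unfolding C_def using disj \<open>finite C\<close> by (subst card_Un_disjoint) (auto simp: C_def card_image[OF inja])
  moreover have "card (Basis - B0) = DIM('a) - card B0"
    using B0 by (simp add: card_Diff_subset finite_subset)
  ultimately have "card (Basis - B0) = card V" by simp
  then obtain g where g: "bij_betw g (Basis - B0) V"
    using \<open>finite C\<close> by (metis C_def finite_Basis finite_Diff finite_Un finite_same_card_bij)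
  define e where "e b = (if b \<in> B0 then a b else g b)" for b
  have e: "bij_betw e Basis C"
  proof -
    have "bij_betw e (B0 \<union> (Basis - B0)) (a ` B0 \<union> V)"
    proof (rule bij_betw_combine)
      show "bij_betw e B0 (a ` B0)"
        using inja by (auto simp: e_def bij_betw_def inj_on_def image_def)
      show "bij_betw e (Basis - B0) V"
        using g by (subst bij_betw_cong[where g=g]) (auto simp: e_def)
      show "a ` B0 \<inter> V = {}" by fact
    qed
    then show ?thesis using B0 by (simp add: C_def Un_absorb1)
  qed
  \<comment> \<open>The coordinates of \<open>x\<close> along \<open>C\<close> are placed on the
    standard basis; Parseval's identity for \<open>C\<close> then gives preservation of the
    norm.\<close>
  define f where "f x = (\<Sum>b\<in>Basis. (x \<bullet> e b) *\<^sub>R b)" for x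
  have fb: "f x \<bullet> b = x \<bullet> e b" if "b \<in> Basis" for x b
    using that by (simp add: f_def inner_sum_left_Basis)
  show ?thesis
  proof (rule that)
    show "linear f"
      by (rule linearI) (simp_all add: f_def inner_add_left scaleR_add_left sum.distrib scaleR_sum_right)
    show "norm (f x) = norm x" for x
    proof -
      have "f x \<bullet> f x = (\<Sum>b\<in>Basis. (x \<bullet> e b) * (x \<bullet> e b))"
        by (subst euclidean_inner) (simp add: fb)
      also have "\<dots> = (\<Sum>c\<in>C. (x \<bullet> c) * (x \<bullet> c))"
        using sum.reindex_bij_betw[OF e, of "\<lambda>c. (x \<bullet> c) * (x \<bullet> c)"] by simp
      also have "\<dots> = x \<bullet> (\<Sum>c\<in>C. (x \<bullet> c) *\<^sub>R c)"
        by (simp add: inner_sum_right)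
      also have "(\<Sum>c\<in>C. (x \<bullet> c) *\<^sub>R c) = x"
        by (rule orthonormal_basis_expand[OF orthC normC]) (auto simp: spanC \<open>finite C\<close>)
      finally show ?thesis by (simp add: norm_eq)
    qed
    show "f x \<bullet> b = x \<bullet> a b" if "b \<in> B0" for x b
      using that B0 by (subst fb) (auto simp: e_def)
  qed
qed

text \<open>Turns the beam outputs into entries of a rotated channel vector. A real linear isometry
  is enough for that, so complex orthonormality of the beams is rewritten as real orthonormality of
  twice as many vectors.\<close>

lemma tdot_linear_isometry:
  fixes v :: "nat \<Rightarrow> complex ^ 'nt" and k :: "nat \<Rightarrow> 'nt"
  assumes inj: "inj_on k I"
    and v: "\<And>m n. m \<in> I \<Longrightarrow> n \<in> I \<Longrightarrow>
        (\<Sum>j\<in>UNIV. cnj (v m $ j) * v n $ j) = (if m = n then 1 else 0)"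
  obtains f :: "complex ^ 'nt \<Rightarrow> complex ^ 'nt" where "linear f" "\<And>x. norm (f x) = norm x"
    "\<And>x i. i \<in> I \<Longrightarrow> f x $ k i = tdot x (v i)"
proof -
  \<comment> \<open>The real inner products of \<open>x\<close> with \<open>cnj (v i)\<close> and \<open>\<i> cnj (v i)\<close> are the real and imaginary
    parts of \<open>tdot x (v i)\<close>.\<close>
  define B0 where "B0 = (\<Union>i\<in>I. {axis (k i) 1, axis (k i) \<i>}) "
  \<comment> \<open>Decodes \<open>b = axis (k i) u\<close>: the position of the only nonzero entry
    gives \<open>i\<close>, and that entry is the factor \<open>u\<close>.\<close>
  define a :: "complex ^ 'nt \<Rightarrow> complex ^ 'nt" where
    "a b = (let i = the_inv_into I k (THE j. b $ j \<noteq> 0) in \<chi> j. b $ (k i) * cnj (v i $ j))" for b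
  have a_axis: "a (axis (k i) u) = (\<chi> j. u * cnj (v i $ j))" if "i \<in> I" "u \<noteq> 0" for i u
  proof -
    have "(THE j. axis (k i) u $ j \<noteq> 0) = k i"
      using that by (intro the_equality) (auto simp: axis_def split: if_splits)
    then show ?thesis using that inj by (simp add: a_def the_inv_into_f_f)
  qed
  \<comment> \<open>The real inner product is the real part of the Hermitian one, so a single
    complex orthogonality relation settles all choices of \<open>u\<close> and \<open>w\<close>,
    including \<open>1\<close> against \<open>\<i>\<close> for the same beam.\<close>
  have inner: "(\<chi> j. u * cnj (v m $ j)) \<bullet> (\<chi> j. w * cnj (v n $ j)) = (if m = n then u \<bullet> w else 0)"
    if "m \<in> I" "n \<in> I" for m n u w
  proof -
    have "(\<chi> j. u * cnj (v m $ j)) \<bullet> (\<chi> j. w * cnj (v n $ j)) =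
      (\<Sum>j\<in>UNIV. Re (u * cnj w * (cnj (v m $ j) * v n $ j)))"
      by (simp add: inner_vec_def inner_complex_def algebra_simps)
    also have "\<dots> = Re (u * cnj w * (\<Sum>j\<in>UNIV. cnj (v m $ j) * v n $ j))"
      by (simp only: sum_distrib_left Re_sum)
    finally show ?thesis using v[OF that] by (simp add: inner_complex_def)
  qed
  obtain f where f: "linear f" "\<And>x. norm (f x) = norm x" "\<And>b x. b \<in> B0 \<Longrightarrow> f x \<bullet> b = x \<bullet> a b"
  proof (rule orthonormal_family_linear_isometry[of B0 a])
    show "B0 \<subseteq> Basis" by (auto simp: B0_def Basis_vec_def Basis_complex_def)
    fix b c assume "b \<in> B0" "c \<in> B0"
    then obtain m n u w where bc: "b = axis (k m) u" "c = axis (k n) w" "m \<in> I" "n \<in> I"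
      "u \<in> {1, \<i>}" "w \<in> {1, \<i>}" by (auto simp: B0_def)
    then have km: "k m = k n \<longleftrightarrow> m = n" using inj by (auto dest: inj_onD)
    have "u \<noteq> 0" "w \<noteq> 0" using bc(5,6) by auto
    then have "a b \<bullet> a c = (if m = n then u \<bullet> w else 0)"
      unfolding bc(1,2) using bc(3,4) by (subst (1 2) a_axis) (simp_all add: inner)
    then show "a b \<bullet> a c = (if b = c then 1 else 0)"
      using bc(5,6) km by (auto simp: bc(1,2) axis_eq_axis inner_complex_def)
  qed (use that in blast)
  show ?thesis
  proof (rule that[OF f(1,2)])
    fix x i assume i: "i \<in> I"
    \<comment> \<open>\<open>u = 1\<close> yields the real part of the entry and
      \<open>u = \<i>\<close> the imaginary part.\<close>
    have "f x $ k i \<bullet> u = Re (tdot x (v i) * cnj u)" if "u \<in> {1, \<i>}" for u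
    proof -
      have "f x $ k i \<bullet> u = f x \<bullet> axis (k i) u" by (simp add: inner_axis)
      also have "\<dots> = x \<bullet> (\<chi> j. u * cnj (v i $ j))"
        using that i by (subst f(3)) (auto simp: B0_def a_axis)
      also have "\<dots> = (\<Sum>j\<in>UNIV. Re (x $ j * v i $ j * cnj u))"
        by (simp add: inner_vec_def inner_complex_def algebra_simps)
      also have "\<dots> = Re (tdot x (v i) * cnj u)"
        by (simp only: tdot_def sum_distrib_right Re_sum)
      finally show ?thesis .
    qed
    from this[of 1] this[of \<i>] show "f x $ k i = tdot x (v i)"
      by (simp add: complex_eq_iff inner_complex_def)
  qed
qed

subsection \<open>Independent exponential variables\<close>

context prob_space
begin

lemma exponential_distributedI:
  assumes [measurable]: "X \<in> borel_measurable M"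
    and tail: "\<And>s. s \<ge> 0 \<Longrightarrow> prob {\<omega> \<in> space M. X \<omega> > s} = exp (- s)"
  shows "distributed M lborel X (exponential_density 1)"
proof -
  have "prob {\<omega> \<in> space M. X \<omega> \<le> a} = 1 - exp (- a * 1)" if "a \<ge> 0" for a
  proof -
    have "{\<omega> \<in> space M. X \<omega> \<le> a} = space M - {\<omega> \<in> space M. X \<omega> > a}" by auto
    then show ?thesis using tail[OF that] by (simp add: prob_compl)
  qed
  then show ?thesis by (subst exponential_distributed_iff) auto
qed

text \<open>Tilting the rate 1 density by \<open>exp (- t * x)\<close> gives
  \<open>1 / (1 + t)\<close> times the density of rate \<open>1 + t\<close>, which has total mass
  1.\<close>

lemma exponential_laplace_transform:
  assumes "distributed M lborel X (exponential_density 1)" and "t \<ge> 0"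
  shows "(\<integral>\<^sup>+\<omega>. ennreal (exp (- t * X \<omega>)) \<partial>M) = ennreal (1 / (1 + t))"
proof -
  have "(\<integral>\<^sup>+\<omega>. ennreal (exp (- t * X \<omega>)) \<partial>M) =
      (\<integral>\<^sup>+x. ennreal (exponential_density 1 x) * ennreal (exp (- t * x)) \<partial>lborel)"
    by (subst distributed_nn_integral[OF assms(1)]) auto
  also have "\<dots> = (\<integral>\<^sup>+x. ennreal (1 / (1 + t)) * ennreal (exponential_density (1 + t) x) \<partial>lborel)"
  proof (rule nn_integral_cong)
    fix x :: real
    have "exponential_density 1 x * exp (- t * x) = 1 / (1 + t) * exponential_density (1 + t) x"
      using \<open>t \<ge> 0\<close> by (simp add: exponential_density_def algebra_simps exp_diff exp_minus field_simps flip: exp_add)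
    then show "ennreal (exponential_density 1 x) * ennreal (exp (- t * x)) =
        ennreal (1 / (1 + t)) * ennreal (exponential_density (1 + t) x)"
      using \<open>t \<ge> 0\<close> by (simp flip: ennreal_mult)
  qed
  also have "\<dots> = ennreal (1 / (1 + t)) * (\<integral>\<^sup>+x. ennreal (exponential_density (1 + t) x) \<partial>lborel)"
    by (rule nn_integral_cmult) auto
  also have "(\<integral>\<^sup>+x. ennreal (exponential_density (1 + t) x) \<partial>lborel) = 1"
    using prob_space.emeasure_space_1[OF prob_space_exponential_density[of "1 + t"]] \<open>t \<ge> 0\<close>
    by (simp add: emeasure_density)
  finally show ?thesis by simp
qed

text \<open>Given the other variables, the tail of \<open>X n\<close> contributes
  \<open>exp (- t * (c + Y))\<close>. Its expectation factors by independence into a constant and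
  one Laplace transform for each remaining index.\<close>

lemma prob_exponential_gt_scaled_sum:
  fixes X :: "'i \<Rightarrow> 'a \<Rightarrow> real"
  assumes ind: "indep_vars (\<lambda>_. borel) X I" and "finite I" "n \<in> I"
    and nonneg: "\<And>i \<omega>. X i \<omega> \<ge> 0"
    and tail: "\<And>i s. i \<in> I \<Longrightarrow> s \<ge> 0 \<Longrightarrow> prob {\<omega> \<in> space M. X i \<omega> > s} = exp (- s)"
    and "t \<ge> 0" "c \<ge> 0"
  shows "prob {\<omega> \<in> space M. X n \<omega> > t * (c + (\<Sum>i\<in>I - {n}. X i \<omega>))} =
    exp (- t * c) / (1 + t) ^ (card I - 1)"
proof -
  define J where "J = I - {n}"
  define Y where "Y \<omega> = (\<Sum>i\<in>J. X i \<omega>)" for \<omega>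
  have J: "finite J" "n \<notin> J" "insert n J = I" using \<open>finite I\<close> \<open>n \<in> I\<close> by (auto simp: J_def)
  have X_meas: "X i \<in> borel_measurable M" if "i \<in> I" for i
    using ind that by (auto simp: indep_vars_def)
  have [measurable]: "X n \<in> borel_measurable M" "Y \<in> borel_measurable M"
    using X_meas \<open>n \<in> I\<close> by (auto simp: Y_def[abs_def] J_def intro!: borel_measurable_sum)
  have Ynn: "Y \<omega> \<ge> 0" for \<omega> by (simp add: Y_def sum_nonneg nonneg)
  have "indep_var borel (X n) borel Y"
    unfolding Y_def using J ind by (intro indep_vars_sum) auto
  then have pair: "distr M borel (X n) \<Otimes>\<^sub>M distr M borel Y = distr M (borel \<Otimes>\<^sub>M borel) (\<lambda>\<omega>. (X n \<omega>, Y \<omega>))"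
    by (simp add: indep_var_distribution_eq)
  interpret D1: prob_space "distr M borel (X n)" by (rule prob_space_distr) simp
  interpret D2: prob_space "distr M borel Y" by (rule prob_space_distr) simp
  interpret D: pair_sigma_finite "distr M borel (X n)" "distr M borel Y" ..
  define S :: "(real \<times> real) set" where "S = {p. fst p > t * (c + snd p)}"
  have [measurable]: "S \<in> sets (borel \<Otimes>\<^sub>M borel)"
  proof -
    have "{p \<in> space (borel \<Otimes>\<^sub>M borel). fst p > t * (c + snd p)} \<in> sets (borel \<Otimes>\<^sub>M borel)"
      by measurable
    then show ?thesis by (simp add: S_def space_pair_measure)
  qed
  have "emeasure M {\<omega> \<in> space M. X n \<omega> > t * (c + Y \<omega>)} =
      emeasure (distr M borel (X n) \<Otimes>\<^sub>M distr M borel Y) S"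
    unfolding pair by (subst emeasure_distr, simp, simp, rule arg_cong[where f="emeasure M"]) (auto simp: S_def)
  also have "\<dots> = (\<integral>\<^sup>+y. emeasure (distr M borel (X n)) ((\<lambda>x. (x, y)) -` S) \<partial>distr M borel Y)"
    by (rule D.emeasure_pair_measure_alt2) simp
  also have "\<dots> = (\<integral>\<^sup>+\<omega>. emeasure (distr M borel (X n)) ((\<lambda>x. (x, Y \<omega>)) -` S) \<partial>M)"
    using D.measurable_emeasure_Pair2[of S] by (intro nn_integral_distr) simp_all
  also have "\<dots> = (\<integral>\<^sup>+\<omega>. ennreal (exp (- t * c)) * (\<Prod>i\<in>J. ennreal (exp (- t * X i \<omega>))) \<partial>M)"
  proof (rule nn_integral_cong)
    fix \<omega>
    have "emeasure (distr M borel (X n)) ((\<lambda>x. (x, Y \<omega>)) -` S) =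
        emeasure M {\<omega>' \<in> space M. X n \<omega>' > t * (c + Y \<omega>)}"
      by (subst emeasure_distr, simp, rule sets_Pair2[where ?M2.0=borel], simp, rule arg_cong[where f="emeasure M"]) (auto simp: S_def)
    also have "\<dots> = ennreal (exp (- (t * (c + Y \<omega>))))"
      using tail[OF \<open>n \<in> I\<close>, of "t * (c + Y \<omega>)"] Ynn \<open>t \<ge> 0\<close> \<open>c \<ge> 0\<close> by (simp add: emeasure_eq_measure)
    also have "exp (- (t * (c + Y \<omega>))) = exp (- t * c) * (\<Prod>i\<in>J. exp (- t * X i \<omega>))"
      using J(1) by (simp add: Y_def exp_sum[symmetric] sum_negf sum_distrib_left algebra_simps flip: exp_add)
    finally show "emeasure (distr M borel (X n)) ((\<lambda>x. (x, Y \<omega>)) -` S) =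
       ennreal (exp (- t * c)) * (\<Prod>i\<in>J. ennreal (exp (- t * X i \<omega>)))"
      by (simp add: ennreal_mult prod_ennreal prod_nonneg)
  qed
  also have "\<dots> = ennreal (exp (- t * c)) * (\<integral>\<^sup>+\<omega>. (\<Prod>i\<in>J. ennreal (exp (- t * X i \<omega>))) \<partial>M)"
    using X_meas J by (intro nn_integral_cmult borel_measurable_prod_ennreal) auto
  also have "(\<integral>\<^sup>+\<omega>. (\<Prod>i\<in>J. ennreal (exp (- t * X i \<omega>))) \<partial>M) =
      (\<Prod>i\<in>J. (\<integral>\<^sup>+\<omega>. ennreal (exp (- t * X i \<omega>)) \<partial>M))"
  proof (rule indep_vars_nn_integral)
    have "indep_vars (\<lambda>_. borel) X J" using ind by (rule indep_vars_subset) (auto simp: J_def)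
    then show "indep_vars (\<lambda>_. borel) (\<lambda>i \<omega>. ennreal (exp (- t * X i \<omega>))) J"
      by (rule indep_vars_compose2) auto
  qed (use J in auto)
  also have "\<dots> = (\<Prod>i\<in>J. ennreal (1 / (1 + t)))"
    using J tail \<open>t \<ge> 0\<close>
    by (intro prod.cong exponential_laplace_transform exponential_distributedI X_meas) auto
  also have "\<dots> = ennreal ((1 / (1 + t)) ^ (card I - 1))"
    using \<open>t \<ge> 0\<close> \<open>n \<in> I\<close> by (simp add: J_def ennreal_power card_Diff_singleton)
  finally show ?thesis
    using \<open>t \<ge> 0\<close>
    by (simp add: Y_def J_def emeasure_eq_measure power_divide flip: ennreal_mult)
qed

text \<open>As \<open>t \<ge> 1\<close> and \<open>c \<ge> 0\<close>, on the event for
  \<open>n\<close> the variable \<open>X n\<close> strictly exceeds all others. Two such events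
  exclude each other, so their equal probabilities add up.\<close>

lemma prob_ex_exponential_gt_scaled_sum:
  fixes X :: "'i \<Rightarrow> 'a \<Rightarrow> real"
  assumes ind: "indep_vars (\<lambda>_. borel) X I" and "finite I"
    and nonneg: "\<And>i \<omega>. X i \<omega> \<ge> 0"
    and tail: "\<And>i s. i \<in> I \<Longrightarrow> s \<ge> 0 \<Longrightarrow> prob {\<omega> \<in> space M. X i \<omega> > s} = exp (- s)"
    and "t \<ge> 1" "c \<ge> 0"
  shows "prob {\<omega> \<in> space M. \<exists>n\<in>I. X n \<omega> > t * (c + (\<Sum>i\<in>I - {n}. X i \<omega>))} =
    card I * exp (- t * c) / (1 + t) ^ (card I - 1)"
proof -
  define A where "A n = {\<omega> \<in> space M. X n \<omega> > t * (c + (\<Sum>i\<in>I - {n}. X i \<omega>))}" for n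
  have X_meas: "X i \<in> borel_measurable M" if "i \<in> I" for i
    using ind that by (auto simp: indep_vars_def)
  have meas: "A n \<in> events" if "n \<in> I" for n
  proof -
    have [measurable]: "X n \<in> borel_measurable M" "(\<lambda>\<omega>. \<Sum>i\<in>I - {n}. X i \<omega>) \<in> borel_measurable M"
      using X_meas that by (auto intro!: borel_measurable_sum)
    show ?thesis unfolding A_def by measurable
  qed
  have gt: "X n \<omega> > X m \<omega>" if "\<omega> \<in> A n" "m \<in> I" "m \<noteq> n" for n m \<omega>
  proof -
    have "X m \<omega> \<le> (\<Sum>i\<in>I - {n}. X i \<omega>)"
      using that \<open>finite I\<close> nonneg by (intro member_le_sum) auto
    also have "\<dots> \<le> c + (\<Sum>i\<in>I - {n}. X i \<omega>)" using \<open>c \<ge> 0\<close> by simp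
    also have "\<dots> \<le> t * (c + (\<Sum>i\<in>I - {n}. X i \<omega>))"
      using \<open>c \<ge> 0\<close> \<open>t \<ge> 1\<close> mult_right_mono[of 1 t "c + (\<Sum>i\<in>I - {n}. X i \<omega>)"] nonneg
      by (simp add: sum_nonneg)
    finally show ?thesis using that by (simp add: A_def)
  qed
  have "disjoint_family_on A I"
    unfolding disjoint_family_on_def
  proof (intro ballI impI equals0I)
    fix m n \<omega> assume "m \<in> I" "n \<in> I" "m \<noteq> n" "\<omega> \<in> A m \<inter> A n"
    then show False using gt[of \<omega> m n] gt[of \<omega> n m] by auto
  qed
  moreover have "{\<omega> \<in> space M. \<exists>n\<in>I. X n \<omega> > t * (c + (\<Sum>i\<in>I - {n}. X i \<omega>))} = (\<Union>n\<in>I. A n)"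
    by (auto simp: A_def)
  ultimately have "prob {\<omega> \<in> space M. \<exists>n\<in>I. X n \<omega> > t * (c + (\<Sum>i\<in>I - {n}. X i \<omega>))} = (\<Sum>n\<in>I. prob (A n))"
    using meas \<open>finite I\<close> by (simp add: finite_measure_finite_Union image_subset_iff)
  also have "\<dots> = (\<Sum>n\<in>I. exp (- t * c) / (1 + t) ^ (card I - 1))"
    unfolding A_def using assms by (intro sum.cong refl prob_exponential_gt_scaled_sum) auto
  finally show ?thesis by simp
qed

text \<open>Independence factors the probability of every measurable rectangle, and rectangles
  determine the product measure. This allows integrating over the channel while the precoding
  vectors are held fixed.\<close>

lemma distr_independent_rvs:
  assumes "independent_rvs M S X S' Y"
  shows "distr M (S \<Otimes>\<^sub>M S') (\<lambda>\<omega>. (X \<omega>, Y \<omega>)) = distr M S X \<Otimes>\<^sub>M distr M S' Y"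
proof -
  have [measurable]: "X \<in> measurable M S" "Y \<in> measurable M S'"
    and ind: "indep_set (sets (vimage_algebra (space M) X S)) (sets (vimage_algebra (space M) Y S'))"
    using assms by (auto simp: independent_rvs_def)
  interpret D1: prob_space "distr M S X" by (rule prob_space_distr) simp
  interpret D2: prob_space "distr M S' Y" by (rule prob_space_distr) simp
  have "distr M S X \<Otimes>\<^sub>M distr M S' Y = distr M (S \<Otimes>\<^sub>M S') (\<lambda>\<omega>. (X \<omega>, Y \<omega>))"
  proof (rule pair_measure_eqI)
    fix A B assume AB: "A \<in> sets (distr M S X)" "B \<in> sets (distr M S' Y)"
    then have [measurable]: "A \<in> sets S" "B \<in> sets S'" by auto
    have "prob ((X -` A \<inter> space M) \<inter> (Y -` B \<inter> space M)) = prob (X -` A \<inter> space M) * prob (Y -` B \<inter> space M)"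
      using AB by (intro indep_setD[OF ind] in_vimage_algebra) auto
    moreover have "(\<lambda>\<omega>. (X \<omega>, Y \<omega>)) -` (A \<times> B) \<inter> space M = (X -` A \<inter> space M) \<inter> (Y -` B \<inter> space M)"
      by auto
    ultimately show "emeasure (distr M S X) A * emeasure (distr M S' Y) B =
        emeasure (distr M (S \<Otimes>\<^sub>M S') (\<lambda>\<omega>. (X \<omega>, Y \<omega>))) (A \<times> B)"
      by (simp add: emeasure_distr emeasure_eq_measure ennreal_mult)
  qed (auto intro: D1.sigma_finite_measure_axioms D2.sigma_finite_measure_axioms)
  then show ?thesis by simp
qed

end

subsection \<open>The coverage probability\<close>

lemma borel_measurable_tdot [measurable]:
  "(\<lambda>p. tdot (fst p) (snd p :: complex ^ 'nt)) \<in> borel_measurable (borel \<Otimes>\<^sub>M borel)"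
proof -
  have [measurable]: "(\<lambda>x. x $ k) \<in> borel_measurable (borel :: (complex ^ 'nt) measure)" for k
    by (intro borel_measurable_continuous_onI continuous_intros)
  show ?thesis unfolding tdot_def by measurable
qed

text \<open>For almost every value of the beams the conditional probability over the channel is the
  same constant \<open>p\<close>, so averaging over the law of the beams leaves
  \<open>p\<close>.\<close>

lemma coverage_prob_eq:
  fixes h :: "'a \<Rightarrow> complex ^ 'nt"
  assumes "prob_space M" "gaussian_channel M h" "orthonormal_precoding M h N \<phi>"
    and N: "1 \<le> N" "N \<le> CARD('nt)" and "\<rho> > 0" "T \<ge> 1"
  shows "coverage_prob M \<rho> T h N \<phi> = N * exp (- T * (N / \<rho>)) / (1 + T) ^ (N - 1)"
proof -
  interpret prob_space M by fact
  define J where "J = {1..N}"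
  have J: "finite J" "J \<noteq> {}" "card J = N" using N by (auto simp: J_def)
  define c where "c = N / \<rho>"
  have "c > 0" using N \<open>\<rho> > 0\<close> by (simp add: c_def)
  define \<Phi> where "\<Phi> \<omega> = (\<lambda>n\<in>J. \<phi> n \<omega>)" for \<omega>
  \<comment> \<open>The coverage event with denominators cleared. It looks at \<open>v\<close> on
    \<open>J\<close> only, so the restricted family \<open>\<Phi>\<close>, a random element of the
    product space, can stand in for \<open>\<phi>\<close>.\<close>
  define E where "E x v \<longleftrightarrow> (\<exists>n\<in>J. (cmod (tdot x (v n)))\<^sup>2 >
      T * (c + (\<Sum>i\<in>J - {n}. (cmod (tdot x (v i)))\<^sup>2)))"
    for x :: "complex ^ 'nt" and v :: "nat \<Rightarrow> complex ^ 'nt"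
  define p where "p = N * exp (- T * c) / (1 + T) ^ (N - 1)"
  let ?V = "PiM J (\<lambda>_. borel :: (complex ^ 'nt) measure)"
  define S where "S = {q \<in> space (borel \<Otimes>\<^sub>M ?V). E (fst q) (snd q)}"
  have ortho: "AE \<omega> in M. \<forall>m\<in>J. \<forall>n\<in>J.
        (\<Sum>k\<in>UNIV. cnj (\<phi> m \<omega> $ k) * \<phi> n \<omega> $ k) = (if m = n then 1 else 0)"
    and ind: "independent_rvs M borel h ?V \<Phi>"
    using assms(3) by (auto simp: orthonormal_precoding_def \<Phi>_def[abs_def] J_def)
  then have [measurable]: "h \<in> borel_measurable M" "\<Phi> \<in> measurable M ?V"
    by (auto simp: independent_rvs_def)
  have [measurable]: "S \<in> sets (borel \<Otimes>\<^sub>M ?V)"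
  proof -
    have [measurable]: "(\<lambda>q. tdot (fst q) (snd q n)) \<in> borel_measurable (borel \<Otimes>\<^sub>M ?V)" if "n \<in> J" for n
    proof -
      have "(\<lambda>q. (fst q, snd q n)) \<in> measurable (borel \<Otimes>\<^sub>M ?V) (borel \<Otimes>\<^sub>M borel)"
        using that by measurable
      from measurable_compose[OF this borel_measurable_tdot] show ?thesis by simp
    qed
    show ?thesis unfolding S_def E_def by measurable
  qed
  have SINR_gt: "SINR \<rho> N x v n > T \<longleftrightarrow>
      (cmod (tdot x (v n)))\<^sup>2 > T * (c + (\<Sum>i\<in>J - {n}. (cmod (tdot x (v i)))\<^sup>2))" for x v n
  proof -
    have "c + (\<Sum>i\<in>J - {n}. (cmod (tdot x (v i)))\<^sup>2) > 0"
      using \<open>c > 0\<close> by (intro add_pos_nonneg sum_nonneg) auto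
    then show ?thesis unfolding SINR_def c_def[symmetric] J_def[symmetric] by (rule pos_less_divide_eq)
  qed
  have "{\<omega> \<in> space M. Max ((\<lambda>n. SINR \<rho> N (h \<omega>) (\<lambda>i. \<phi> i \<omega>) n) ` J) > T} =
      {\<omega> \<in> space M. E (h \<omega>) (\<lambda>i. \<phi> i \<omega>)}"
    using J by (subst Max_gr_iff) (auto simp: SINR_gt E_def)
  also have "\<dots> = (\<lambda>\<omega>. (h \<omega>, \<Phi> \<omega>)) -` S \<inter> space M"
  proof -
    have "E x (\<Phi> \<omega>) \<longleftrightarrow> E x (\<lambda>i. \<phi> i \<omega>)" for x \<omega>
      by (simp add: E_def \<Phi>_def)
    moreover have "(h \<omega>, \<Phi> \<omega>) \<in> space (borel \<Otimes>\<^sub>M ?V)" if "\<omega> \<in> space M" for \<omega>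
      using that by (intro measurable_space[of "\<lambda>\<omega>. (h \<omega>, \<Phi> \<omega>)" M]) simp_all
    ultimately show ?thesis by (auto simp: S_def)
  qed
  finally have "emeasure M {\<omega> \<in> space M. Max ((\<lambda>n. SINR \<rho> N (h \<omega>) (\<lambda>i. \<phi> i \<omega>) n) ` J) > T} =
      emeasure (distr M (borel \<Otimes>\<^sub>M ?V) (\<lambda>\<omega>. (h \<omega>, \<Phi> \<omega>))) S"
    by (simp add: emeasure_distr)
  also have "\<dots> = emeasure (distr M borel h \<Otimes>\<^sub>M distr M ?V \<Phi>) S"
    by (simp add: distr_independent_rvs[OF ind])
  also have "\<dots> = (\<integral>\<^sup>+\<omega>. emeasure (distr M borel h) ((\<lambda>x. (x, \<Phi> \<omega>)) -` S) \<partial>M)"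
  proof -
    interpret D1: prob_space "distr M borel h" by (rule prob_space_distr) simp
    interpret D2: prob_space "distr M ?V \<Phi>" by (rule prob_space_distr) simp
    interpret D: pair_sigma_finite "distr M borel h" "distr M ?V \<Phi>" ..
    have "emeasure (distr M borel h \<Otimes>\<^sub>M distr M ?V \<Phi>) S =
        (\<integral>\<^sup>+v. emeasure (distr M borel h) ((\<lambda>x. (x, v)) -` S) \<partial>distr M ?V \<Phi>)"
      by (rule D.emeasure_pair_measure_alt2) simp
    also have "\<dots> = (\<integral>\<^sup>+\<omega>. emeasure (distr M borel h) ((\<lambda>x. (x, \<Phi> \<omega>)) -` S) \<partial>M)"
      using D.measurable_emeasure_Pair2[of S] by (intro nn_integral_distr) simp_all
    finally show ?thesis .
  qed
  also have "\<dots> = (\<integral>\<^sup>+\<omega>. ennreal p \<partial>M)"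
  proof (rule nn_integral_cong_AE)
    show "AE \<omega> in M. emeasure (distr M borel h) ((\<lambda>x. (x, \<Phi> \<omega>)) -` S) = ennreal p"
      using ortho AE_space
    proof eventually_elim
      fix \<omega>
      assume on: "\<forall>m\<in>J. \<forall>n\<in>J.
        (\<Sum>k\<in>UNIV. cnj (\<phi> m \<omega> $ k) * \<phi> n \<omega> $ k) = (if m = n then 1 else 0)" and "\<omega> \<in> space M"
      \<comment> \<open>\<open>N \<le> CARD('nt)\<close> leaves room for \<open>N\<close> distinct
        channel entries. Both \<open>k\<close> and the isometry \<open>f\<close> are chosen
        separately for each outcome; only the constant value \<open>p\<close> survives the
        choice.\<close>
      obtain k :: "nat \<Rightarrow> 'nt" where k: "inj_on k J"
        using card_le_inj[of J "UNIV :: 'nt set"] N J by auto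
      obtain f :: "complex ^ 'nt \<Rightarrow> complex ^ 'nt" where f: "linear f" "\<And>x. norm (f x) = norm x"
        "\<And>x i. i \<in> J \<Longrightarrow> f x $ k i = tdot x (\<phi> i \<omega>)"
        using tdot_linear_isometry[OF k, of "\<lambda>i. \<phi> i \<omega>"] on by blast
      have [measurable]: "f \<in> borel_measurable borel"
        using f(1) by (intro borel_measurable_continuous_onI) (simp add: linear_continuous_on linear_conv_bounded_linear)
      have [measurable]: "(\<lambda>x. x $ j) \<in> borel_measurable (borel :: (complex ^ 'nt) measure)" for j
        by (intro borel_measurable_continuous_onI continuous_intros)
      define I where "I = k ` J"
      define A where "A = {y :: complex ^ 'nt. \<exists>n\<in>I. (cmod (y $ n))\<^sup>2 > T * (c + (\<Sum>i\<in>I - {n}. (cmod (y $ i))\<^sup>2))}"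
      have [measurable]: "A \<in> sets borel" unfolding A_def by measurable
      have "(\<lambda>x. (x, \<Phi> \<omega>)) -` S = f -` A"
      proof -
        have sum: "(\<Sum>i\<in>I - {k n}. (cmod (f x $ i))\<^sup>2) = (\<Sum>i\<in>J - {n}. (cmod (tdot x (\<phi> i \<omega>)))\<^sup>2)"
          if "n \<in> J" for x n
        proof -
          have "I - {k n} = k ` (J - {n})"
            using k that by (auto simp: I_def dest: inj_onD)
          moreover have "inj_on k (J - {n})" using k by (rule inj_on_subset) auto
          ultimately show ?thesis by (simp add: sum.reindex f(3))
        qed
        have "f x \<in> A \<longleftrightarrow> E x (\<lambda>i. \<phi> i \<omega>)" for x
        proof -
          have "f x \<in> A \<longleftrightarrow> (\<exists>n\<in>J. (cmod (f x $ k n))\<^sup>2 > T * (c + (\<Sum>i\<in>I - {k n}. (cmod (f x $ i))\<^sup>2)))"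
            by (auto simp: A_def I_def)
          also have "\<dots> \<longleftrightarrow> E x (\<lambda>i. \<phi> i \<omega>)"
            unfolding E_def by (rule bex_cong) (simp_all add: sum f(3))
          finally show ?thesis .
        qed
        moreover have "E x (\<Phi> \<omega>) \<longleftrightarrow> E x (\<lambda>i. \<phi> i \<omega>)" for x
          by (simp add: E_def \<Phi>_def)
        moreover have "(x, \<Phi> \<omega>) \<in> space (borel \<Otimes>\<^sub>M ?V)" for x
          using measurable_space[OF \<open>\<Phi> \<in> measurable M ?V\<close> \<open>\<omega> \<in> space M\<close>] by (simp add: space_pair_measure)
        ultimately show ?thesis by (auto simp: S_def)
      qed
      then have "emeasure (distr M borel h) ((\<lambda>x. (x, \<Phi> \<omega>)) -` S) = emeasure (distr (distr M borel h) borel f) A"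
        by (simp add: emeasure_distr)
      \<comment> \<open>Rotation invariance removes \<open>f\<close>: from here on only entries of
        the original channel occur, which are independent by assumption.\<close>
      also have "distr (distr M borel h) borel f = distr M borel h"
        unfolding gaussian_channel_distr[OF assms(1,2)]
        by (rule gaussian_distr_linear_isometry) (simp_all add: f)
      also have "emeasure (distr M borel h) A = emeasure M {\<omega> \<in> space M. h \<omega> \<in> A}"
        by (simp add: emeasure_distr vimage_def Int_def conj_commute)
      also have "\<dots> = ennreal p"
      proof -
        have "prob {\<omega> \<in> space M. h \<omega> \<in> A} = card I * exp (- T * c) / (1 + T) ^ (card I - 1)"
          unfolding A_def mem_Collect_eq
        proof (rule prob_ex_exponential_gt_scaled_sum)
          have "indep_vars (\<lambda>_. borel) (\<lambda>k \<omega>. h \<omega> $ k) I"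
            using assms(2) indep_vars_subset[of "\<lambda>_. borel" "\<lambda>k \<omega>. h \<omega> $ k" UNIV I]
            by (auto simp: gaussian_channel_def)
          then show "indep_vars (\<lambda>_. borel) (\<lambda>k \<omega>. (cmod (h \<omega> $ k))\<^sup>2) I"
            by (rule indep_vars_compose2) auto
          show "prob {\<omega> \<in> space M. (cmod (h \<omega> $ i))\<^sup>2 > s} = exp (- s)" if "s \<ge> 0" for i s
            using emeasure_std_complex_gaussian_norm_gt[of M "\<lambda>\<omega>. h \<omega> $ i" s] assms(1,2) that
            by (simp add: gaussian_channel_def emeasure_eq_measure)
        qed (use \<open>c > 0\<close> \<open>T \<ge> 1\<close> J in \<open>auto simp: I_def\<close>)
        also have "card I = N" using k J by (simp add: I_def card_image)
        finally show ?thesis by (simp add: emeasure_eq_measure p_def)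
      qed
      finally show "emeasure (distr M borel h) ((\<lambda>x. (x, \<Phi> \<omega>)) -` S) = ennreal p" .
    qed
  qed
  also have "\<dots> = ennreal p" by (simp add: emeasure_space_1)
  finally show ?thesis
    using \<open>T \<ge> 1\<close> by (simp add: coverage_prob_def emeasure_eq_measure p_def c_def J_def)
qed

section \<open>Monotonicity of the closed form in the number of beams\<close>

text \<open>The step is asked for all \<open>n \<ge> m\<close> because it is checked for a closed
  form defined on all naturals; \<open>A\<close> then cuts out the admissible numbers of
  beams.\<close>

lemma strict_antimono_on_natI:
  fixes f :: "nat \<Rightarrow> 'a::order"
  assumes step: "\<And>n. m \<le> n \<Longrightarrow> f (Suc n) < f n" and A: "A \<subseteq> {m..}"
  shows "strict_antimono_on A f"
proof (rule monotone_onI)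
  fix a b assume "a \<in> A" "b \<in> A" "a < b"
  then have "m \<le> a" using A by auto
  obtain d where "b = a + Suc d" using \<open>a < b\<close> less_imp_Suc_add by auto
  moreover have "f (a + Suc d) < f a"
  proof (induction d)
    case 0
    then show ?case using step[of a] \<open>m \<le> a\<close> by simp
  next
    case (Suc d)
    have "f (Suc (a + Suc d)) < f (a + Suc d)" using \<open>m \<le> a\<close> by (intro step) simp
    with Suc show ?case by (auto intro: order.strict_trans)
  qed
  ultimately show "f b < f a" by simp
qed

theorem mainTheorem4:
  fixes M :: "'a measure"
    and h :: "'a \<Rightarrow> complex ^ 'nt"
    and \<phi> :: "nat \<Rightarrow> nat \<Rightarrow> 'a \<Rightarrow> complex ^ 'nt"
    and \<rho> T :: real
    and P :: "nat \<Rightarrow> real"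
  assumes "prob_space M"
    and "gaussian_channel M h"
    and "\<And>N. 1 \<le> N \<Longrightarrow> N \<le> CARD('nt) \<Longrightarrow> orthonormal_precoding M h N (\<phi> N)"
    and "\<rho> > 0" and "T \<ge> 1"
  defines "P \<equiv> \<lambda>N. coverage_prob M \<rho> T h N (\<phi> N)"
  shows "strict_antimono_on {1..CARD('nt)} P
    \<and> (Max (P ` {1..CARD('nt)}) = exp (- T / \<rho>) \<and> P 1 = exp (- T / \<rho>))
    \<and> strict_antimono_on {N. 2 \<le> N \<and> N + 1 \<le> CARD('nt)} (\<lambda>N. P N - P (N + 1))"
proof -
  define y where "y = exp (- T / \<rho>)"
  define z where "z = y / (1 + T)"
  \<comment> \<open>There are \<open>N\<close> factors \<open>y\<close> but only
    \<open>N - 1\<close> factors \<open>1 + T\<close>, hence the separate \<open>y\<close> in front.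
    \<open>f\<close> is meant to agree with \<open>P\<close> for
    \<open>1 \<le> N \<le> CARD('nt)\<close> only.\<close>
  define f where "f N = y * (real N * z ^ (N - 1))" for N
  have y: "0 < y" "y < 1" using assms(4,5) by (simp_all add: y_def)
  have z: "0 < z" "z < 1 / 2"
  proof -
    show "0 < z" using y assms(5) by (simp add: z_def)
    have "z < 1 / (1 + T)" using y assms(5) by (simp add: z_def divide_strict_right_mono)
    also have "\<dots> \<le> 1 / 2" using assms(5) by (intro divide_left_mono) auto
    finally show "z < 1 / 2" .
  qed
  have P: "P N = f N" if "1 \<le> N" "N \<le> CARD('nt)" for N
  proof -
    have "P N = N * exp (- T * (N / \<rho>)) / (1 + T) ^ (N - 1)"
      unfolding P_def using that assms by (intro coverage_prob_eq) auto
    also have "exp (- T * (N / \<rho>)) = y ^ N"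
      by (simp add: y_def exp_of_nat_mult[symmetric] algebra_simps)
    also have "y ^ N = y * y ^ (N - 1)" using that by (cases N) auto
    finally show ?thesis by (simp add: f_def z_def power_divide)
  qed
  have dec: "f (Suc n) < f n" if n: "1 \<le> n" for n
  proof -
    obtain m where m: "n = Suc m" using n by (cases n) auto
    \<comment> \<open>The ratio of consecutive values is \<open>(n + 1) * z / n\<close>, which is
      below 1 because \<open>z < 1/2\<close> and \<open>n + 1 \<le> 2 * n\<close>.\<close>
    have "real (Suc n) * z < real n"
    proof -
      have "real (Suc n) * z < real (Suc n) * (1 / 2)" using z by (intro mult_strict_left_mono) auto
      also have "\<dots> \<le> real n" using that by simp
      finally show ?thesis .
    qed
    then have "y * z ^ m * (real (Suc n) * z) < y * z ^ m * real n"
      using y z by (intro mult_strict_left_mono) auto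
    then show ?thesis by (simp add: f_def m mult_ac)
  qed
  have convex: "f (Suc n) - f (Suc (Suc n)) < f n - f (Suc n)" if n: "2 \<le> n" for n
  proof -
    obtain m where m: "n = Suc m" using n by (cases n) auto
    have "f n - 2 * f (Suc n) + f (Suc (Suc n)) =
        y * z ^ m * (n - 2 * (n + 1) * z + (n + 2) * z\<^sup>2)"
      by (simp add: f_def m algebra_simps power2_eq_square)
    moreover have "n - 2 * (n + 1) * z + (n + 2) * z\<^sup>2 > 0"
    proof -
      \<comment> \<open>At \<open>z = 1/2\<close> the quadratic takes the value
        \<open>(n - 2) / 4\<close>; splitting this off leaves a multiple of \<open>1/2 - z\<close>.
        The restriction to \<open>n \<ge> 2\<close> is what makes that value nonnegative.\<close>
      have "n - 2 * (n + 1) * z + (n + 2) * z\<^sup>2 =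
        (1 / 2 - z) * ((3 * n + 2) / 2 - (n + 2) * z) + (real n - 2) / 4"
        by (simp add: field_simps power2_eq_square)
      moreover have "(n + 2) * z < (3 * n + 2) / 2"
      proof -
        have "(n + 2) * z \<le> real (n + 2) * (1 / 2)" using z by (intro mult_left_mono) auto
        also have "\<dots> < (3 * n + 2) / 2" using that by simp
        finally show ?thesis .
      qed
      then have "(1 / 2 - z) * ((3 * n + 2) / 2 - (n + 2) * z) > 0" using z by simp
      moreover have "(real n - 2) / 4 \<ge> 0" using n by simp
      ultimately show ?thesis by linarith
    qed
    ultimately have "f n - 2 * f (Suc n) + f (Suc (Suc n)) > 0" using y z by simp
    then show ?thesis by simp
  qed
  have card: "1 \<le> CARD('nt)" by (simp add: Suc_le_eq)
  have P1: "P 1 = y" using P[of 1] card by (simp add: f_def)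
  have anti: "strict_antimono_on {1..CARD('nt)} P"
    using strict_antimono_on_natI[of 1 f "{1..CARD('nt)}"] dec P by (auto simp: monotone_on_def)
  have "Max (P ` {1..CARD('nt)}) = y"
  proof (rule Max_eqI)
    fix q assume "q \<in> P ` {1..CARD('nt)}"
    then obtain N where N: "q = P N" "1 \<le> N" "N \<le> CARD('nt)" by auto
    then show "q \<le> y"
      using monotone_onD[OF anti, of 1 N] P1 by (cases "N = 1") auto
  qed (use P1 card in auto)
  \<comment> \<open>\<open>N + 1 \<le> CARD('nt)\<close> keeps both terms of the decrement in the
    range where \<open>P\<close> equals \<open>f\<close>.\<close>
  moreover have "strict_antimono_on {N. 2 \<le> N \<and> N + 1 \<le> CARD('nt)} (\<lambda>N. P N - P (N + 1))"
    using strict_antimono_on_natI[of 2 "\<lambda>N. f N - f (Suc N)" "{N. 2 \<le> N \<and> N + 1 \<le> CARD('nt)}"] convex P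
    by (auto simp: monotone_on_def)
  ultimately show ?thesis using anti P1 by (simp add: y_def)
qed

end
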